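(* Let $\mathbb{G}_m=\mathbb{G}_m(q,q)$ be a generalized $m$-gon of order $(q,q)$ and $\mathbb{G}_n=\mathbb{G}_n(r,r)$ a generalized $n$-gon of order $(r,r)$, both admitting polarities, and let $P_m(\mathbb{G}_m)$ and $P_n(\mathbb{G}_n)$ be their polarity quotient graphs with respect to non-rotation polarities. Let $P(\mathbb{G}_m\odot\mathbb{G}_n)$ be the resulting composed-polarity quotient graph of $\mathbb{G}_m\odot\mathbb{G}_n$. Then the isomorphic graphs $P(\mathbb{G}_m\odot\mathbb{G}_n)$ and $P_m(\mathbb{G}_m)\otimes P_n(\mathbb{G}_n)$ have diameter $D=\max(m,n)-1$.
   Context: Graphs are undirected, without multi-edges; self-loops are allowed. Generalized polygons: for an integer $n\ge2$, a generalized $n$-gon is a point-line geometry whose bipartite point-line incidence graph has diameter $n$ and girth $2n$. It has order $(s,t)$ if every line is incident with $s+1$ points and every point with $t+1$ lines. $\mathbb{G}_n(q,q)$ ($q\ge1$) denotes the incidence graph (parts: points and lines) of a generalized $n$-gon of order $(q,q)$. The case $q=1$ (thin) is allowed: then $\mathbb{G}_n(1,1)$ is the cycle $C_{2n}$. Polarity: for a bipartite graph $\mathbb{G}$ with parts $A,B$, a polarity is a graph automorphism $\rho$ that is an involution with $\rho(A)=B$, $\rho(B)=A$. The rotation polarity is the rotation of $C_{2n}=\mathbb{G}_n(1,1)$ by $\pi$ radians when $n$ is odd; every other polarity of a generalized polygon is a non-rotation polarity. Polarity quotient: $P(\mathbb{G})$ has as vertices the orbits $[v]=\{v,\rho(v)\}$,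 with $[v],[w]$ adjacent whenever some $v'\in[v]$, $w'\in[w]$ are adjacent in $\mathbb{G}$; multi-edges are merged, self-loops are retained. Kronecker product: $H\otimes K$ has vertex set $V(H)\times V(K)$, with $((h_1,k_1),(h_2,k_2))$ an edge if and only if $(h_1,h_2)\in E(H)$ and $(k_1,k_2)\in E(K)$. If $\mathbb{H},\mathbb{K}$ are connected bipartite graphs with parts $A_H,B_H$ and $A_K,B_K$ that admit polarities $\rho_H,\rho_K$, then $\mathbb{H}\otimes\mathbb{K}$ has two isomorphic components, with vertex sets $(A_H\times A_K)\cup(B_H\times B_K)$ and $(A_H\times B_K)\cup(B_H\times A_K)$; $\mathbb{H}\odot\mathbb{K}$ denotes one of them, and the composed polarity on it is $\rho((h,k))=(\rho_H(h),\rho_K(k))$. *)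

theory Defs
  imports "Graph_Theory.Graph_Theory" "HOL-Library.Extended_Nat"
begin

text \<open>
  An undirected graph, possibly with self-loops but without multi-edges, is a
  \<^typ>\<open>'a pair_pre_digraph\<close> whose arc relation is symmetric: an edge joining \<open>u\<close> and \<open>v\<close> is
  the pair of arcs \<open>(u,v)\<close>, \<open>(v,u)\<close>, and a self-loop at \<open>v\<close> is the arc \<open>(v,v)\<close>.
\<close>

section \<open>Distance, diameter, girth, isomorphisms\<close>

definition graph_dist :: "'a pair_pre_digraph \<Rightarrow> 'a \<Rightarrow> 'a \<Rightarrow> enat" where
  "graph_dist G u v = (INF p \<in> {p. pre_digraph.awalk G u p v}. enat (length p))"

definition graph_diameter :: "'a pair_pre_digraph \<Rightarrow> enat" where
  "graph_diameter G = (SUP u \<in> pverts G. SUP v \<in> pverts G. graph_dist G u v)"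

text \<open>
  The digraph notion of cycle also admits \<open>u, v, u\<close>, which runs back and forth along one
  undirected edge; as there are no multi-edges, these are exactly the closed walks of length 2
  that have to be discarded.
\<close>
definition girth :: "'a pair_pre_digraph \<Rightarrow> enat" where
  "girth G = (INF p \<in> {p. pre_digraph.cycle G p \<and> length p \<noteq> 2}. enat (length p))"

definition graph_isomorphism :: "('a \<Rightarrow> 'b) \<Rightarrow> 'a pair_pre_digraph \<Rightarrow> 'b pair_pre_digraph \<Rightarrow> bool" where
  "graph_isomorphism f G H \<longleftrightarrow>
     bij_betw f (pverts G) (pverts H) \<and>
     (\<forall>u \<in> pverts G. \<forall>v \<in> pverts G. (u, v) \<in> parcs G \<longleftrightarrow> (f u, f v) \<in> parcs H)"

text \<open>Vertex-level isomorphisms yield the isomorphism relation of the graph library.\<close>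
lemma digraph_iso_if_graph_isomorphism:
  assumes "pair_wf_digraph G" "pair_wf_digraph H" "graph_isomorphism f G H"
  shows "digraph_iso G H"
proof -
  interpret G: pair_wf_digraph G by fact
  interpret H: pair_wf_digraph H by fact
  let ?h = "\<lparr>iso_verts = f, iso_arcs = map_prod f f, iso_head = snd, iso_tail = fst\<rparr>"
  have bij: "bij_betw f (pverts G) (pverts H)"
    and adj: "\<And>u v. \<lbrakk>u \<in> pverts G; v \<in> pverts G\<rbrakk> \<Longrightarrow> (u, v) \<in> parcs G \<longleftrightarrow> (f u, f v) \<in> parcs H"
    using assms(3) unfolding graph_isomorphism_def by blast+
  have inj: "inj_on f (pverts G)" and im: "f ` pverts G = pverts H"
    using bij unfolding bij_betw_def by blast+
  have sub: "parcs G \<subseteq> pverts G \<times> pverts G"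
    by (rule subrelI) (blast dest: G.wellformed')
  have "inj_on (map_prod f f) (parcs G)"
    using map_prod_inj_on[OF inj inj] sub by (rule inj_on_subset)
  then have "pre_digraph.digraph_isomorphism G ?h"
    using inj G.wf_digraph by (simp add: pre_digraph.digraph_isomorphism_def)
  moreover have "map_prod f f ` parcs G = parcs H"
  proof
    show "map_prod f f ` parcs G \<subseteq> parcs H"
    proof
      fix e assume "e \<in> map_prod f f ` parcs G"
      then obtain u v where uv: "(u, v) \<in> parcs G" "e = (f u, f v)" by auto
      then show "e \<in> parcs H"
        using adj[OF G.wellformed'[OF uv(1)]] by blast
    qed
    show "parcs H \<subseteq> map_prod f f ` parcs G"
    proof (rule subrelI)
      fix x y assume xy: "(x, y) \<in> parcs H"
      then obtain u v where uv: "u \<in> pverts G" "v \<in> pverts G" and eq: "x = f u" "y = f v"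
        using H.wellformed'[OF xy] im by blast
      have "(u, v) \<in> parcs G"
        using adj[OF uv] xy eq by blast
      then show "(x, y) \<in> map_prod f f ` parcs G"
        unfolding eq by (rule image_eqI[rotated]) simp
    qed
  qed
  then have "with_proj H = app_iso ?h G"
    by (simp add: im app_iso_def with_proj_def)
  ultimately show ?thesis
    unfolding digraph_iso_def by blast
qed

section \<open>Generalized polygons\<close>

text \<open>
  The incidence graph of the geometry with point set \<open>P\<close>, line set \<open>L\<close> and incidence
  relation \<open>I\<close> has parts \<open>Inl ` P\<close> and \<open>Inr ` L\<close>.
\<close>
definition incidence_graph :: "'p set \<Rightarrow> 'l set \<Rightarrow> ('p \<times> 'l) set \<Rightarrow> ('p + 'l) pair_pre_digraph" where
  "incidence_graph P L I =
     \<lparr> pverts = Inl ` P \<union> Inr ` L,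
       parcs = (\<Union>(p, l) \<in> I. {(Inl p, Inr l), (Inr l, Inl p)}) \<rparr>"

definition generalized_polygon :: "nat \<Rightarrow> 'p set \<Rightarrow> 'l set \<Rightarrow> ('p \<times> 'l) set \<Rightarrow> bool" where
  "generalized_polygon n P L I \<longleftrightarrow>
     2 \<le> n \<and> I \<subseteq> P \<times> L \<and>
     graph_diameter (incidence_graph P L I) = enat n \<and>
     girth (incidence_graph P L I) = enat (2 * n)"

definition has_order :: "'p set \<Rightarrow> 'l set \<Rightarrow> ('p \<times> 'l) set \<Rightarrow> nat \<Rightarrow> nat \<Rightarrow> bool" where
  "has_order P L I s t \<longleftrightarrow>
     (\<forall>l \<in> L. card {p \<in> P. (p, l) \<in> I} = s + 1) \<and>
     (\<forall>p \<in> P. card {l \<in> L. (p, l) \<in> I} = t + 1)"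

section \<open>Polarities and polarity quotients\<close>

definition polarity :: "'a pair_pre_digraph \<Rightarrow> 'a set \<Rightarrow> 'a set \<Rightarrow> ('a \<Rightarrow> 'a) \<Rightarrow> bool" where
  "polarity G A B \<rho> \<longleftrightarrow>
     graph_isomorphism \<rho> G G \<and> (\<forall>v \<in> pverts G. \<rho> (\<rho> v) = v) \<and> \<rho> ` A = B \<and> \<rho> ` B = A"

definition cycle_graph :: "nat \<Rightarrow> nat pair_pre_digraph" where
  "cycle_graph k =
     \<lparr> pverts = {..<k},
       parcs = {(i, j). i < k \<and> j < k \<and> (j = Suc i mod k \<or> i = Suc j mod k)} \<rparr>"

text \<open>
  Rotation of the \<open>2n\<close>-cycle by \<open>\<pi>\<close> advances every vertex by \<open>n\<close> steps. The choice of the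
  identification \<open>f\<close> is immaterial, because this rotation is central in the automorphism
  group of the cycle.
\<close>
definition rotation_polarity :: "nat \<Rightarrow> 'a pair_pre_digraph \<Rightarrow> ('a \<Rightarrow> 'a) \<Rightarrow> bool" where
  "rotation_polarity n G \<rho> \<longleftrightarrow>
     odd n \<and>
     (\<exists>f. graph_isomorphism f (cycle_graph (2 * n)) G \<and>
          (\<forall>i < 2 * n. \<rho> (f i) = f ((i + n) mod (2 * n))))"

definition polarity_quotient :: "'a pair_pre_digraph \<Rightarrow> ('a \<Rightarrow> 'a) \<Rightarrow> 'a set pair_pre_digraph" where
  "polarity_quotient G \<rho> =
     \<lparr> pverts = {{v, \<rho> v} | v. v \<in> pverts G},
       parcs = {({v, \<rho> v}, {w, \<rho> w}) | v w. v \<in> pverts G \<and> w \<in> pverts G \<and>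
                  (\<exists>v' \<in> {v, \<rho> v}. \<exists>w' \<in> {w, \<rho> w}. (v', w') \<in> parcs G)} \<rparr>"

section \<open>Kronecker products\<close>

definition kronecker :: "'a pair_pre_digraph \<Rightarrow> 'b pair_pre_digraph \<Rightarrow> ('a \<times> 'b) pair_pre_digraph"
    (infixl "\<otimes>\<^sub>K" 70) where
  "H \<otimes>\<^sub>K K =
     \<lparr> pverts = pverts H \<times> pverts K,
       parcs = {((h1, k1), (h2, k2)). (h1, h2) \<in> parcs H \<and> (k1, k2) \<in> parcs K} \<rparr>"

definition pair_induced :: "'a pair_pre_digraph \<Rightarrow> 'a set \<Rightarrow> 'a pair_pre_digraph" where
  "pair_induced G U = \<lparr> pverts = U, parcs = parcs G \<inter> U \<times> U \<rparr>"

text \<open>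
  For bipartite \<open>H\<close>, \<open>K\<close> with parts \<open>A\<close>, \<open>B\<close> and \<open>C\<close>, \<open>D\<close>, the product \<open>H \<odot> K\<close> denotes
  either of the two components of \<open>H \<otimes>\<^sub>K K\<close>; it is rendered as a graph ranging over this set.
\<close>
definition kronecker_components ::
    "'a pair_pre_digraph \<Rightarrow> 'a set \<Rightarrow> 'a set \<Rightarrow> 'b pair_pre_digraph \<Rightarrow> 'b set \<Rightarrow> 'b set
     \<Rightarrow> ('a \<times> 'b) pair_pre_digraph set" where
  "kronecker_components H A B K C D =
     {pair_induced (H \<otimes>\<^sub>K K) (A \<times> C \<union> B \<times> D), pair_induced (H \<otimes>\<^sub>K K) (A \<times> D \<union> B \<times> C)}"

definition composed_polarity :: "('a \<Rightarrow> 'a) \<Rightarrow> ('b \<Rightarrow> 'b) \<Rightarrow> 'a \<times> 'b \<Rightarrow> 'a \<times> 'b" where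
  "composed_polarity \<rho> \<sigma> = (\<lambda>(h, k). (\<rho> h, \<sigma> k))"

end

theory Submission
  imports Defs
begin

text \<open>
  A walk of length \<open>k\<close> in a Kronecker product is a pair of walks of length \<open>k\<close> in the factors. The
  diameter of \<open>P(G) \<otimes>\<^sub>K P(H)\<close> is therefore decided by the exact lengths of walks in the polarity
  quotients, and these are read off from the polygons: walks of length \<open>k\<close> from \<open>[v]\<close> to \<open>[w]\<close> in
  \<open>P(G)\<close> come from walks of length \<open>k\<close> in \<open>G\<close> from \<open>v\<close> to \<open>w\<close> or to \<open>\<rho> w\<close> (\<open>relpow_quotient_iff\<close>). Of
  these two targets exactly one lies in the part that the parity of \<open>k\<close> allows, and it is reached by a
  walk of length \<open>k\<close> if and only if its distance from \<open>v\<close> is at most \<open>k\<close>.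
  
  In a generalized \<open>m\<close>-gon all distances are at most \<open>m\<close>, and parity excludes distance \<open>m\<close> for walks of
  length \<open>m - 1\<close>. Hence all lengths \<open>k \<ge> m - 1\<close> occur between any two orbits
  (\<open>walk_to_orbit\<close>), and the length \<open>max m n - 1\<close> occurs in both factors at once, which bounds the diameter
  from above.
  
  The bound is attained if some \<open>v\<close> and \<open>u\<close> satisfy \<open>d v u = m - 1\<close> and \<open>d v (\<rho> u) = m\<close>
  (\<open>orbit_at_distance\<close>). In the thick case \<open>q \<ge> 2\<close>, such a pair is reached from any opposite pair
  \<open>v\<close>, \<open>\<rho> u\<close> by moving \<open>u\<close> away from \<open>v\<close>, the third neighbour of each vertex giving the freedom to keep
  \<open>\<rho> u\<close> opposite to \<open>v\<close> (\<open>far_orbit_if_thick\<close>). In the thin case the graph is a cycle. If some vertex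
  is absolute, i.e. adjacent to its image, its opposite does the job (\<open>far_orbit_if_absolute\<close>); if
  none is, every vertex is mapped to an opposite one (\<open>absolute_or_all_opposite\<close>), and the polarity
  is the rotation of the cycle (\<open>rotation_if_all_opposite\<close>). The geometric input is
  \<open>unique_closer_neighbour\<close>: by the girth condition geodesics shorter than \<open>m\<close> are unique.
  
  Finally, the orbits of the composed polarity on either component of \<open>G \<otimes>\<^sub>K H\<close> correspond to pairs of
  orbits by taking both projections, and this is an isomorphism onto the product of the quotients
  (\<open>component_quotient_iso\<close>), so that both graphs have the same diameter.
\<close>

section \<open>Walks as relational powers\<close>

lemma awalk_iff_relpow:
  assumes "pair_wf_digraph G"
  shows "(\<exists>p. pre_digraph.awalk G u p v \<and> length p = k) \<longleftrightarrow> u \<in> pverts G \<and> (u, v) \<in> parcs G ^^ k"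
proof -
  interpret pair_wf_digraph G by fact
  show ?thesis
  proof (induction k arbitrary: u)
    case 0
    show ?case by (auto simp: awalk_Nil_iff)
  next
    case (Suc k)
    have "(\<exists>p. awalk u p v \<and> length p = Suc k) \<longleftrightarrow>
        (\<exists>w. (u, w) \<in> parcs G \<and> (\<exists>p. awalk w p v \<and> length p = k))"
    proof
      assume "\<exists>p. awalk u p v \<and> length p = Suc k"
      then obtain e p where "awalk u (e # p) v" "length p = k"
        by (auto simp: length_Suc_conv)
      then show "\<exists>w. (u, w) \<in> parcs G \<and> (\<exists>p. awalk w p v \<and> length p = k)"
        by (cases e) (auto simp: awalk_Cons_iff)
    next
      assume "\<exists>w. (u, w) \<in> parcs G \<and> (\<exists>p. awalk w p v \<and> length p = k)"
      then obtain w p where "awalk u ((u, w) # p) v" "length p = k"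
        by (auto simp: awalk_Cons_iff)
      then show "\<exists>p. awalk u p v \<and> length p = Suc k"
        by (intro exI[of _ "(u, w) # p"]) simp
    qed
    also have "\<dots> \<longleftrightarrow> (\<exists>w. (u, w) \<in> parcs G \<and> (w, v) \<in> parcs G ^^ k)"
      unfolding Suc.IH by (auto dest: in_arcsD2)
    also have "\<dots> \<longleftrightarrow> u \<in> pverts G \<and> (u, v) \<in> parcs G ^^ Suc k"
      using relpow_Suc_I2[of u _ "parcs G" v k] relpow_Suc_D2[of u v k "parcs G"] in_arcsD1[of u]
      by blast
    finally show ?case .
  qed
qed

lemma graph_dist_le_iff:
  assumes "pair_wf_digraph G" "u \<in> pverts G"
  shows "graph_dist G u v \<le> enat k \<longleftrightarrow> (\<exists>j\<le>k. (u, v) \<in> parcs G ^^ j)"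
proof -
  have "graph_dist G u v \<le> enat k \<longleftrightarrow> graph_dist G u v < enat (Suc k)"
    by (cases "graph_dist G u v") auto
  also have "\<dots> \<longleftrightarrow> (\<exists>p. pre_digraph.awalk G u p v \<and> length p \<le> k)"
    unfolding graph_dist_def INF_less_iff by auto
  also have "\<dots> \<longleftrightarrow> (\<exists>j\<le>k. \<exists>p. pre_digraph.awalk G u p v \<and> length p = j)"
    by blast
  finally show ?thesis
    using awalk_iff_relpow[OF assms(1)] assms(2) by simp
qed

lemma graph_diameter_le_iff:
  assumes "pair_wf_digraph G"
  shows "graph_diameter G \<le> enat k \<longleftrightarrow>
    (\<forall>u\<in>pverts G. \<forall>v\<in>pverts G. \<exists>j\<le>k. (u, v) \<in> parcs G ^^ j)"
  unfolding graph_diameter_def SUP_le_iff using graph_dist_le_iff[OF assms] by blast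

text \<open>
  The supremum defining the diameter is attained because the distances are extended natural
  numbers; the successor form keeps out the empty graph, whose diameter is also 0.
\<close>
lemma graph_diameter_eq_Suc_iff:
  assumes "pair_wf_digraph G"
  shows "graph_diameter G = enat (Suc k) \<longleftrightarrow>
    (\<forall>u\<in>pverts G. \<forall>v\<in>pverts G. \<exists>j\<le>Suc k. (u, v) \<in> parcs G ^^ j) \<and>
    (\<exists>u\<in>pverts G. \<exists>v\<in>pverts G. \<forall>j\<le>k. (u, v) \<notin> parcs G ^^ j)"
proof -
  have "d = enat (Suc k) \<longleftrightarrow> d \<le> enat (Suc k) \<and> \<not> d \<le> enat k" for d
    by (cases d) auto
  then show ?thesis
    unfolding graph_diameter_le_iff[OF assms, symmetric]
    using graph_diameter_le_iff[OF assms, of k] by blast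
qed

lemma relpow_iso:
  assumes "pair_wf_digraph G" "pair_wf_digraph H" "graph_isomorphism f G H"
    and "u \<in> pverts G" "v \<in> pverts G"
  shows "(f u, f v) \<in> parcs H ^^ k \<longleftrightarrow> (u, v) \<in> parcs G ^^ k"
  using \<open>v \<in> pverts G\<close>
proof (induction k arbitrary: v)
  case 0
  then show ?case
    using assms(3,4) by (auto simp: graph_isomorphism_def bij_betw_def inj_on_def)
next
  case (Suc k)
  interpret G: pair_wf_digraph G by fact
  interpret H: pair_wf_digraph H by fact
  have arc: "(f x, f y) \<in> parcs H \<longleftrightarrow> (x, y) \<in> parcs G" if "x \<in> pverts G" "y \<in> pverts G" for x y
    using assms(3) that by (auto simp: graph_isomorphism_def)
  have surj: "pverts H = f ` pverts G"
    using assms(3) by (auto simp: graph_isomorphism_def bij_betw_def)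
  show ?case
  proof
    assume "(f u, f v) \<in> parcs H ^^ Suc k"
    then obtain y where y: "(f u, y) \<in> parcs H ^^ k" "(y, f v) \<in> parcs H" by auto
    then obtain x where "x \<in> pverts G" "y = f x"
      using H.in_arcsD1 surj by blast
    then show "(u, v) \<in> parcs G ^^ Suc k"
      using y Suc arc by auto
  next
    assume "(u, v) \<in> parcs G ^^ Suc k"
    then obtain x where x: "(u, x) \<in> parcs G ^^ k" "(x, v) \<in> parcs G" by auto
    then have "x \<in> pverts G" using G.in_arcsD1 by blast
    then show "(f u, f v) \<in> parcs H ^^ Suc k"
      using x Suc arc by auto
  qed
qed

lemma graph_diameter_iso:
  assumes "pair_wf_digraph G" "pair_wf_digraph H" "graph_isomorphism f G H"
  shows "graph_diameter H = graph_diameter G"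
proof -
  have surj: "pverts H = f ` pverts G"
    using assms(3) by (auto simp: graph_isomorphism_def bij_betw_def)
  have "graph_diameter H \<le> enat k \<longleftrightarrow> graph_diameter G \<le> enat k" for k
    unfolding graph_diameter_le_iff[OF assms(1)] graph_diameter_le_iff[OF assms(2)] surj
    using relpow_iso[OF assms] by auto
  from this[of "the_enat (graph_diameter G)"] this[of "the_enat (graph_diameter H)"]
  show ?thesis
    by (cases "graph_diameter G"; cases "graph_diameter H") auto
qed

text \<open>
  Cycles are handled as functions on the indices \<open>0, \<dots>, k\<close>, which suits arguments that splice two
  paths; this lemma turns such a function into a cycle in the sense of arc lists. The bound
  \<open>3 \<le> k\<close> keeps it clear of the discarded closed walks of length 2.
\<close>
lemma girth_le_cycle_length:
  assumes "pair_wf_digraph G" and "3 \<le> k"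
    and "c k = c 0" "\<And>i. i < k \<Longrightarrow> (c i, c (Suc i)) \<in> parcs G" "inj_on c {1..k}"
  shows "girth G \<le> enat k"
proof -
  interpret pair_wf_digraph G by fact
  let ?p = "\<lambda>j. map (\<lambda>i. (c i, c (Suc i))) [0..<j]"
  have c0: "c 0 \<in> pverts G" using assms(2) assms(4)[of 0] in_arcsD1 by auto
  have walk: "j \<le> k \<Longrightarrow> awalk (c 0) (?p j) (c j)" for j
  proof (induction j)
    case 0
    show ?case using c0 by (simp add: awalk_Nil_iff)
  next
    case (Suc j)
    then have "awalk (c 0) (?p j) (c j)" "(c j, c (Suc j)) \<in> parcs G"
      using assms(4) by auto
    then show ?case
      by (auto intro!: awalk_appendI simp: awalk_simps dest: in_arcsD2)
  qed
  have verts: "tl (pawalk_verts (c 0) (?p k)) = map c [1..<Suc k]"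
  proof -
    have "pawalk_verts (c 0) (?p k) = c 0 # map c [1..<Suc k]"
      using assms(2)
      by (auto simp add: awalk_verts_conv last_map upt_conv_Cons[of 0 k] comp_def)
    then show ?thesis by simp
  qed
  have "distinct (map c [1..<Suc k])"
    using assms(5) by (simp add: distinct_map atLeastLessThanSuc_atLeastAtMost del: upt_Suc)
  then have "cycle (?p k)"
    unfolding cycle_def using walk[of k] assms(2,3) verts by (auto intro!: exI[of _ "c 0"] simp del: upt_Suc)
  then show ?thesis
    unfolding girth_def using assms(2) by (intro INF_lower2[of "?p k"]) auto
qed

section \<open>Distances in the incidence graph of a generalized polygon\<close>

text \<open>
  Points and lines are interchangeable in what follows, so the incidence graph of a generalized
  \<open>n\<close>-gon of order \<open>(q, q)\<close> is considered abstractly. Only one part \<open>A\<close> is named, the other one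
  being its complement in the vertex set.
\<close>
locale polygon_graph =
  fixes G :: "'a pair_pre_digraph" and A :: "'a set" and n q :: nat
  assumes wf: "pair_wf_digraph G"
    and sym_arcs: "(u, v) \<in> parcs G \<Longrightarrow> (v, u) \<in> parcs G"
    and bipartite: "(u, v) \<in> parcs G \<Longrightarrow> (u \<in> A) \<noteq> (v \<in> A)"
    and n_ge_2: "2 \<le> n"
    and diameter: "graph_diameter G = enat n"
    and girth: "girth G = enat (2 * n)"
    and q_ge_1: "1 \<le> q"
    and degree: "v \<in> pverts G \<Longrightarrow> card {w. (v, w) \<in> parcs G} = q + 1"
begin

abbreviation "V \<equiv> pverts G"
abbreviation "E \<equiv> parcs G"

definition d :: "'a \<Rightarrow> 'a \<Rightarrow> nat" where
  "d u v = (LEAST k. (u, v) \<in> E ^^ k)"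

lemma arcD: "(u, v) \<in> E \<Longrightarrow> u \<in> V" "(u, v) \<in> E \<Longrightarrow> v \<in> V"
  using pair_wf_digraph.in_arcsD1[OF wf] pair_wf_digraph.in_arcsD2[OF wf] by blast+

lemma relpow_sym: "(u, v) \<in> E ^^ k \<Longrightarrow> (v, u) \<in> E ^^ k"
  by (induction k arbitrary: v) (auto intro: relpow_Suc_I2 sym_arcs simp del: relpow.simps(2) elim!: relpow_Suc_E)

lemma diameter_bounds:
  shows "u \<in> V \<Longrightarrow> v \<in> V \<Longrightarrow> \<exists>k\<le>n. (u, v) \<in> E ^^ k"
    and "\<exists>u\<in>V. \<exists>v\<in>V. \<forall>k<n. (u, v) \<notin> E ^^ k"
proof -
  obtain n' where "n = Suc n'" using n_ge_2 by (cases n) auto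
  with diameter graph_diameter_eq_Suc_iff[OF wf]
  show "u \<in> V \<Longrightarrow> v \<in> V \<Longrightarrow> \<exists>k\<le>n. (u, v) \<in> E ^^ k"
    and "\<exists>u\<in>V. \<exists>v\<in>V. \<forall>k<n. (u, v) \<notin> E ^^ k"
    by (simp_all add: less_Suc_eq_le)
qed

lemma d_le: "(u, v) \<in> E ^^ k \<Longrightarrow> d u v \<le> k"
  unfolding d_def by (rule Least_le)

lemma walk_d: "u \<in> V \<Longrightarrow> v \<in> V \<Longrightarrow> (u, v) \<in> E ^^ d u v"
  unfolding d_def using diameter_bounds(1) by (metis LeastI)

lemma d_le_n: "u \<in> V \<Longrightarrow> v \<in> V \<Longrightarrow> d u v \<le> n"
  using diameter_bounds(1) d_le le_trans by blast

lemma d_sym: "d u v = d v u"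
  unfolding d_def using relpow_sym by metis

lemma d_eq_0_iff: "u \<in> V \<Longrightarrow> v \<in> V \<Longrightarrow> d u v = 0 \<longleftrightarrow> u = v"
  using walk_d[of u v] d_le[of u v 0] by auto

lemma d_triangle: "u \<in> V \<Longrightarrow> v \<in> V \<Longrightarrow> w \<in> V \<Longrightarrow> d u w \<le> d u v + d v w"
  by (intro d_le relpow_trans[of _ v] walk_d)

lemma walk_parity: "(u, v) \<in> E ^^ k \<Longrightarrow> even k \<longleftrightarrow> ((u \<in> A) = (v \<in> A))"
  by (induction k arbitrary: v) (auto dest!: bipartite)

lemma d_parity: "u \<in> V \<Longrightarrow> v \<in> V \<Longrightarrow> even (d u v) \<longleftrightarrow> ((u \<in> A) = (v \<in> A))"
  using walk_parity walk_d by blast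

lemma d_arc:
  assumes "v \<in> V" "(x, y) \<in> E"
  shows "d v y = Suc (d v x) \<or> d v x = Suc (d v y)"
proof -
  have "x \<in> V" "y \<in> V" using arcD assms by blast+
  then have "(v, y) \<in> E ^^ Suc (d v x)" "(v, x) \<in> E ^^ Suc (d v y)"
    using walk_d[OF \<open>v \<in> V\<close>] sym_arcs assms(2) by auto
  moreover have "d v x \<noteq> d v y"
    using d_parity[OF \<open>v \<in> V\<close> \<open>x \<in> V\<close>] d_parity[OF \<open>v \<in> V\<close> \<open>y \<in> V\<close>] bipartite[OF assms(2)] by auto
  ultimately show ?thesis
    using d_le[of v y "Suc (d v x)"] d_le[of v x "Suc (d v y)"] by linarith
qed

lemma closer_neighbour:
  assumes "v \<in> V" "x \<in> V" "d v x = Suc k"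
  obtains y where "(x, y) \<in> E" "d v y = k"
proof -
  obtain y where y: "(v, y) \<in> E ^^ k" "(y, x) \<in> E"
    using walk_d[OF assms(1,2)] assms(3) by auto
  then have "d v y = k"
    using d_le[OF y(1)] d_arc[OF assms(1) y(2)] assms(3) by auto
  then show thesis using that sym_arcs[OF y(2)] by blast
qed

lemma relpow_segment:
  assumes "\<And>i. i < k \<Longrightarrow> (a i, a (Suc i)) \<in> R" "i \<le> j" "j \<le> k"
  shows "(a i, a j) \<in> R ^^ (j - i)"
  unfolding relpow_fun_conv using assms by (intro exI[of _ "\<lambda>l. a (i + l)"]) auto

lemma geodesic:
  assumes "v \<in> V" "x \<in> V" "(x, y) \<in> E" "d v y < d v x"
  obtains a where "a 0 = x" "a (Suc 0) = y" "a (d v x) = v"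
    "\<And>i. i < d v x \<Longrightarrow> (a i, a (Suc i)) \<in> E" "\<And>i. i \<le> d v x \<Longrightarrow> a i \<in> V"
    "\<And>i. i \<le> d v x \<Longrightarrow> d v (a i) = d v x - i"
proof -
  have y: "y \<in> V" "d v x = Suc (d v y)"
    using arcD assms(3) d_arc[OF assms(1,3)] assms(4) by auto
  obtain f where f: "f 0 = y" "f (d v y) = v" "\<And>i. i < d v y \<Longrightarrow> (f i, f (Suc i)) \<in> E"
    using relpow_sym[OF walk_d[OF assms(1) y(1)]] unfolding relpow_fun_conv by blast
  define a where "a = case_nat x f"
  have a: "a 0 = x" "a (Suc 0) = y" "a (d v x) = v"
    using f(1,2) y(2) by (simp_all add: a_def)
  have arcs: "(a i, a (Suc i)) \<in> E" if "i < d v x" for i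
    using that f assms(3) y(2) by (cases i) (auto simp: a_def)
  have V: "a i \<in> V" if "i \<le> d v x" for i
    using arcs[of i] arcD assms(1) a(3) that by (cases "i = d v x") auto
  have dist: "d v (a i) = d v x - i" if i: "i \<le> d v x" for i
  proof -
    have "(x, a i) \<in> E ^^ i" "(a i, v) \<in> E ^^ (d v x - i)"
      using relpow_segment[of "d v x" a E 0 i] relpow_segment[of "d v x" a E i "d v x"] arcs a i
      by auto
    then have "d x (a i) \<le> i" "d v (a i) \<le> d v x - i"
      using d_le relpow_sym by blast+
    moreover have "d v x \<le> d v (a i) + d (a i) x"
      using d_triangle assms V[OF i] by blast
    ultimately show ?thesis
      using d_sym[of x "a i"] i by simp
  qed
  show thesis
    using that[OF a arcs V dist] by blast
qed

text \<open>
  Below distance \<open>n\<close>, geodesics are unique: two neighbours \<open>y \<noteq> z\<close> of \<open>x\<close> closer to \<open>v\<close> start two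
  geodesics from \<open>x\<close> to \<open>v\<close>, and following them up to the first vertex where they meet again closes a
  cycle of length at most \<open>2 * d v x < 2 * n\<close>, against the girth. Since points on the geodesics are at
  prescribed distances from \<open>v\<close>, the two branches can meet only at equal levels.
\<close>
lemma unique_closer_neighbour:
  assumes "v \<in> V" "x \<in> V" "d v x < n"
    and "(x, y) \<in> E" "d v y < d v x" "(x, z) \<in> E" "d v z < d v x"
  shows "y = z"
proof (rule ccontr)
  assume "y \<noteq> z"
  let ?k = "d v x"
  obtain a where a: "a 0 = x" "a (Suc 0) = y" "a ?k = v" "\<And>i. i < ?k \<Longrightarrow> (a i, a (Suc i)) \<in> E"
    "\<And>i. i \<le> ?k \<Longrightarrow> d v (a i) = ?k - i"
    using geodesic[OF assms(1,2,4,5)] by metis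
  obtain b where b: "b 0 = x" "b (Suc 0) = z" "b ?k = v" "\<And>i. i < ?k \<Longrightarrow> (b i, b (Suc i)) \<in> E"
    "\<And>i. i \<le> ?k \<Longrightarrow> d v (b i) = ?k - i"
    using geodesic[OF assms(1,2,6,7)] by metis
  \<comment> \<open>The two geodesics meet again at the latest in \<open>v\<close>.\<close>
  define j where "j = (LEAST i. 1 \<le> i \<and> a i = b i)"
  have k: "1 \<le> ?k" using assms(5) by simp
  then have j: "1 \<le> j" "a j = b j" "j \<le> ?k"
    using LeastI[of "\<lambda>i. 1 \<le> i \<and> a i = b i" ?k] Least_le[of "\<lambda>i. 1 \<le> i \<and> a i = b i" ?k] a(3) b(3)
    unfolding j_def by auto
  have before: "a i \<noteq> b i" if "1 \<le> i" "i < j" for i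
    using not_less_Least[of i "\<lambda>i. 1 \<le> i \<and> a i = b i"] that unfolding j_def by blast
  have "j \<noteq> 1" using \<open>y \<noteq> z\<close> j(2) a(2) b(2) by auto
  \<comment> \<open>Go out along \<open>a\<close> and come back along \<open>b\<close>.\<close>
  define c where "c i = (if i \<le> j then a i else b (2 * j - i))" for i
  have "girth G \<le> enat (2 * j)"
  proof (rule girth_le_cycle_length[OF wf])
    show "3 \<le> 2 * j" using j(1) \<open>j \<noteq> 1\<close> by simp
    show "c (2 * j) = c 0" using a(1) b(1) j(1) by (simp add: c_def)
    show "(c i, c (Suc i)) \<in> E" if "i < 2 * j" for i
    proof -
      consider "i < j" | "i = j" | "j < i" by linarith
      then show ?thesis
      proof cases
        case 1
        then show ?thesis using a(4)[of i] j(3) by (simp add: c_def)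
      next
        case 2
        then show ?thesis
          using b(4)[of "j - 1"] j by (simp add: c_def sym_arcs)
      next
        case 3
        then show ?thesis
          using b(4)[of "2 * j - Suc i"] j(3) that
          by (simp add: c_def Suc_diff_Suc sym_arcs)
      qed
    qed
    have level: "d v (c i) = (if i \<le> j then ?k - i else ?k - (2 * j - i))" if "i \<le> 2 * j" for i
      using that j(3) a(5) b(5) by (auto simp: c_def)
    have "i = i'" if i: "i \<in> {1..2 * j}" "i' \<in> {1..2 * j}" and c: "c i = c i'" and "i \<le> i'" for i i'
    proof (rule ccontr)
      assume "i \<noteq> i'"
      have "d v (c i) = d v (c i')" using c by simp
      then have "i < j" "j < i'" "2 * j - i' = i"
        using level[of i] level[of i'] i \<open>i \<noteq> i'\<close> \<open>i \<le> i'\<close> j(3) by (auto split: if_splits)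
      then show False
        using before[of i] c i by (simp add: c_def)
    qed
    then show "inj_on c {1..2 * j}"
      unfolding inj_on_def by (metis nat_le_linear)
  qed
  then show False
    using girth j(3) assms(3) by simp
qed

lemma finite_neighbours: "v \<in> V \<Longrightarrow> finite {w. (v, w) \<in> E}"
  using degree[of v] by (metis add_is_0 card.infinite one_neq_zero)

lemma neighbour_avoiding:
  assumes "v \<in> V" "finite S" "card S \<le> q"
  obtains w where "(v, w) \<in> E" "w \<notin> S"
proof -
  have "\<not> {w. (v, w) \<in> E} \<subseteq> S"
    using card_mono[OF assms(2), of "{w. (v, w) \<in> E}"] degree[OF assms(1)] assms(3) by auto
  then show thesis using that by blast
qed

text \<open>
  At most one of the \<open>q + 1\<close> neighbours of \<open>x\<close> is closer to \<open>v\<close>, which leaves at least \<open>q\<close> farther ones; fewer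
  than \<open>q\<close> of them can be forbidden.
\<close>
lemma farther_neighbour:
  assumes "v \<in> V" "x \<in> V" "d v x < n" "finite S" "card S < q"
  obtains y where "(x, y) \<in> E" "d v y = Suc (d v x)" "y \<notin> S"
proof -
  obtain z where z: "\<And>y. (x, y) \<in> E \<Longrightarrow> d v y < d v x \<Longrightarrow> y = z"
    using unique_closer_neighbour[OF assms(1-3)] by metis
  have "card (insert z S) \<le> q"
    using assms(4,5) by (simp add: card_insert_if)
  then obtain y where "(x, y) \<in> E" "y \<notin> insert z S"
    using neighbour_avoiding[OF assms(2), of "insert z S"] assms(4) by auto
  then show thesis
    using that[of y] z[of y] d_arc[OF assms(1), of x y] by auto
qed

lemma opposite_exists:
  assumes "v \<in> V"
  obtains w where "w \<in> V" "d v w = n"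
proof -
  have "\<exists>w\<in>V. d v w = k" if "k \<le> n" for k
    using that
  proof (induction k)
    case 0
    then show ?case using assms d_eq_0_iff by blast
  next
    case (Suc k)
    then obtain w where "w \<in> V" "d v w = k" by auto
    then obtain y where "(w, y) \<in> E" "d v y = Suc k"
      using farther_neighbour[OF assms, of w "{}"] Suc.prems q_ge_1 by auto
    then show ?case using arcD by blast
  qed
  then show thesis using that by blast
qed

lemma walk_lengthen:
  assumes "v \<in> V" "(u, v) \<in> E ^^ k"
  shows "(u, v) \<in> E ^^ (k + 2 * i)"
proof (induction i)
  case (Suc i)
  obtain w where "(v, w) \<in> E"
    using neighbour_avoiding[OF assms(1), of "{}"] by auto
  then have "(u, v) \<in> E ^^ Suc (Suc (k + 2 * i))"
    using Suc sym_arcs by auto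
  then show ?case by simp
qed (use assms in simp)

text \<open>
  Walks can be lengthened by running back and forth along an edge, so only parity obstructs a
  length that is at least the distance.
\<close>
lemma walk_iff_d:
  assumes "u \<in> V" "v \<in> V" "even k \<longleftrightarrow> ((u \<in> A) = (v \<in> A))"
  shows "(u, v) \<in> E ^^ k \<longleftrightarrow> d u v \<le> k"
proof
  assume "d u v \<le> k"
  moreover have "even k = even (d u v)"
    using d_parity assms by simp
  ultimately have "k = d u v + 2 * ((k - d u v) div 2)"
    by presburger
  then show "(u, v) \<in> E ^^ k"
    using walk_lengthen[OF assms(2) walk_d[OF assms(1,2)]] by metis
qed (rule d_le)

end

section \<open>Polarities of a generalized polygon\<close>

locale polarized_polygon = polygon_graph +
  fixes \<rho> :: "'a \<Rightarrow> 'a"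
  assumes iso: "graph_isomorphism \<rho> G G"
    and involution: "v \<in> V \<Longrightarrow> \<rho> (\<rho> v) = v"
    and swaps: "v \<in> V \<Longrightarrow> (\<rho> v \<in> A) \<noteq> (v \<in> A)"
begin

lemma polarity_V: "v \<in> V \<Longrightarrow> \<rho> v \<in> V"
  using iso by (auto simp: graph_isomorphism_def bij_betw_def)

lemma relpow_polarity: "u \<in> V \<Longrightarrow> v \<in> V \<Longrightarrow> (\<rho> u, \<rho> v) \<in> E ^^ k \<longleftrightarrow> (u, v) \<in> E ^^ k"
  by (rule relpow_iso[OF wf wf iso])

lemma arc_polarity: "(u, v) \<in> E \<Longrightarrow> (\<rho> u, \<rho> v) \<in> E"
  using relpow_polarity[of u v 1] arcD by auto

lemma d_polarity: "u \<in> V \<Longrightarrow> v \<in> V \<Longrightarrow> d (\<rho> u) (\<rho> v) = d u v"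
  unfolding d_def using relpow_polarity by simp

lemma d_polarity_swap: "u \<in> V \<Longrightarrow> v \<in> V \<Longrightarrow> d u (\<rho> v) = d v (\<rho> u)"
  using d_polarity[of u "\<rho> v"] involution[of v] polarity_V[of v] d_sym by simp

lemma odd_d_polarity: "v \<in> V \<Longrightarrow> odd (d v (\<rho> v))"
  using d_parity[of v "\<rho> v"] swaps polarity_V by auto

text \<open>
  The two vertices of an orbit lie in different parts, so one of them, \<open>v'\<close>, is at a distance from
  \<open>u\<close> of the parity of \<open>k\<close>. The distance is at most \<open>n\<close>, and it is not \<open>n\<close> when \<open>k = n - 1\<close>; hence it
  is at most \<open>k\<close>.
\<close>
lemma walk_to_orbit:
  assumes "u \<in> V" "v \<in> V" "n - 1 \<le> k"
  shows "\<exists>v'\<in>{v, \<rho> v}. (u, v') \<in> E ^^ k"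
proof -
  obtain v' where v': "v' \<in> {v, \<rho> v}" "even k \<longleftrightarrow> ((u \<in> A) = (v' \<in> A))"
    using swaps[OF assms(2)] by blast
  then have "v' \<in> V" using assms(2) polarity_V by auto
  moreover have "d u v' \<le> k"
  proof -
    have "d u v' \<le> n" "even (d u v') = even k"
      using d_le_n d_parity assms(1) \<open>v' \<in> V\<close> v'(2) by auto
    then show ?thesis
      using assms(3) n_ge_2 by presburger
  qed
  ultimately show ?thesis
    using walk_iff_d assms(1) v' by blast
qed

text \<open>
  Begin with opposite vertices \<open>v\<close> and \<open>\<rho> u\<close>, and push \<open>u\<close> away from \<open>v\<close> by two steps at a time while
  keeping its image opposite to \<open>v\<close>. Step from \<open>u\<close> to a farther vertex \<open>x\<close>. Its image \<open>\<rho> x\<close> is at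
  distance \<open>n - 1\<close> from \<open>v\<close>, so it has \<open>q\<close> neighbours opposite to \<open>v\<close>. One of them is \<open>\<rho> u\<close>, and as
  \<open>q \<ge> 2\<close> there is another one, \<open>z\<close>. Then \<open>\<rho> z\<close> is a neighbour of \<open>x\<close> other than \<open>u\<close>, hence farther from
  \<open>v\<close> than \<open>x\<close>. This ends at distance \<open>n - 1\<close>, since by parity \<open>n - 2\<close> does not occur.
\<close>
lemma far_orbit_if_thick:
  assumes "2 \<le> q"
  shows "\<exists>v\<in>V. \<exists>u\<in>V. d v u = n - 1 \<and> d v (\<rho> u) = n"
proof -
  have step: "\<exists>u'\<in>V. d v u' = n - 1 \<and> d v (\<rho> u') = n"
    if "v \<in> V" "u \<in> V" "d v (\<rho> u) = n" for u v
    using that(2,3)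
  proof (induction "n - d v u" arbitrary: u rule: less_induct)
    case less
    have par: "even (d v u) \<noteq> even n"
      using d_parity[OF \<open>v \<in> V\<close> less.prems(1)] d_parity[OF \<open>v \<in> V\<close> polarity_V[OF less.prems(1)]]
        swaps[OF less.prems(1)] less.prems(2) by auto
    have le: "d v u \<le> n" using d_le_n \<open>v \<in> V\<close> less.prems(1) by blast
    show ?case
    proof (cases "d v u = n - 1")
      case True
      then show ?thesis using less.prems by blast
    next
      case False
      then have far: "d v u + 3 \<le> n"
        using par le by presburger
      obtain x where x: "(u, x) \<in> E" "d v x = Suc (d v u)"
        using farther_neighbour[OF \<open>v \<in> V\<close> less.prems(1), of "{}"] far assms by auto
      then have xV: "x \<in> V" "\<rho> x \<in> V" using arcD polarity_V by blast+
      have \<rho>x: "(\<rho> u, \<rho> x) \<in> E" using arc_polarity x(1) .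
      then have "d v (\<rho> x) < n"
        using d_arc[OF \<open>v \<in> V\<close> \<rho>x] d_le_n[OF \<open>v \<in> V\<close> xV(2)] less.prems(2) by auto
      then obtain z where z: "(\<rho> x, z) \<in> E" "d v z = Suc (d v (\<rho> x))" "z \<notin> {\<rho> u}"
        using farther_neighbour[OF \<open>v \<in> V\<close> xV(2), of "{\<rho> u}"] assms by auto
      then have zV: "z \<in> V" "\<rho> z \<in> V" using arcD polarity_V by blast+
      have dz: "d v z = n"
        using z(2) d_arc[OF \<open>v \<in> V\<close> \<rho>x] d_le_n[OF \<open>v \<in> V\<close> zV(1)] less.prems(2) by auto
      have xz: "(x, \<rho> z) \<in> E" using arc_polarity[OF z(1)] involution xV by simp
      have "\<rho> z \<noteq> u" using z(3) involution[OF zV(1)] by auto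
      then have "\<not> d v (\<rho> z) < d v x"
        using unique_closer_neighbour[OF \<open>v \<in> V\<close> xV(1), of u "\<rho> z"] x far xz sym_arcs by auto
      then have "d v u < d v (\<rho> z)"
        using x(2) by simp
      then show ?thesis
        using less.hyps[of "\<rho> z"] zV dz far involution by simp
    qed
  qed
  obtain v where v: "v \<in> V" using diameter_bounds(2) by blast
  obtain w where "w \<in> V" "d v w = n" using opposite_exists[OF v] .
  then show ?thesis
    using step[OF v, of "\<rho> w"] v polarity_V involution by auto
qed

text \<open>
  If \<open>w\<close> is opposite to the absolute vertex \<open>v\<close>, then \<open>\<rho> w\<close> is opposite to \<open>\<rho> v\<close>, which is a neighbour
  of \<open>v\<close>; so \<open>\<rho> w\<close> is at distance \<open>n - 1\<close> from \<open>v\<close>.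
\<close>
lemma far_orbit_if_absolute:
  assumes "(v, \<rho> v) \<in> E"
  shows "\<exists>u\<in>V. d v u = n - 1 \<and> d v (\<rho> u) = n"
proof -
  have v: "v \<in> V" "\<rho> v \<in> V" using arcD assms by blast+
  obtain w where w: "w \<in> V" "d v w = n" using opposite_exists[OF v(1)] .
  have "d (\<rho> w) (\<rho> v) = n"
    using d_polarity[OF w(1) v(1)] w d_sym by simp
  moreover have "d (\<rho> w) v \<le> n"
    using d_le_n polarity_V w v by blast
  ultimately have "d v (\<rho> w) = n - 1"
    using d_arc[OF polarity_V[OF w(1)] assms] d_sym[of v "\<rho> w"] by auto
  then show ?thesis
    using w polarity_V involution by (intro bexI[of _ "\<rho> w"]) auto
qed

text \<open>
  If \<open>d v (\<rho> v) < n\<close>, then \<open>\<rho>\<close> reverses the unique geodesic from \<open>v\<close> to \<open>\<rho> v\<close> and therefore flips its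
  middle edge, whose ends are absolute. Taking \<open>v\<close> with minimal \<open>d v (\<rho> v)\<close> makes one step of this
  reversal enough: the neighbour \<open>x\<close> of \<open>v\<close> on the geodesic would have \<open>d x (\<rho> x) = d v (\<rho> v) - 2\<close>.
\<close>
lemma absolute_or_all_opposite:
  "(\<exists>v. (v, \<rho> v) \<in> E) \<or> (\<forall>v\<in>V. d v (\<rho> v) = n)"
proof -
  obtain v where v: "v \<in> V" and min: "\<And>w. w \<in> V \<Longrightarrow> d v (\<rho> v) \<le> d w (\<rho> w)"
    using ex_has_least_nat[of "\<lambda>v. v \<in> V" _ "\<lambda>v. d v (\<rho> v)"] diameter_bounds(2) by metis
  define j where "j = d v (\<rho> v)"
  note \<rho>v = polarity_V[OF v]
  have "odd j" using odd_d_polarity[OF v] by (simp add: j_def)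
  moreover have "j \<le> n" using d_le_n[OF v \<rho>v] by (simp add: j_def)
  ultimately have "j = 1 \<or> (3 \<le> j \<and> j < n) \<or> j = n" by presburger
  then consider "j = 1" | "3 \<le> j" "j < n" | "j = n" by blast
  then show ?thesis
  proof cases
    case 1
    then show ?thesis using walk_d[OF v \<rho>v] by (auto simp: j_def)
  next
    case 2
    obtain x where x: "(v, x) \<in> E" "d (\<rho> v) x = j - 1"
      using closer_neighbour[OF \<rho>v v, of "j - 1"] d_sym[of v "\<rho> v"] 2 by (auto simp: j_def)
    have xV: "x \<in> V" using arcD x by blast
    have "d x (\<rho> v) = Suc (j - 2)" using x(2) d_sym[of x "\<rho> v"] 2 by simp
    then obtain y where y: "(\<rho> v, y) \<in> E" "d x y = j - 2"
      using closer_neighbour[OF xV \<rho>v] by blast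
    have "d v (\<rho> x) < d v (\<rho> v)"
      using d_polarity_swap[OF v xV] d_sym[of x "\<rho> v"] x(2) 2 j_def by simp
    moreover have "d v y < d v (\<rho> v)"
      using d_triangle[OF v xV, of y] d_le[of v x 1] x(1) y arcD 2 j_def by fastforce
    ultimately have "y = \<rho> x"
      using unique_closer_neighbour[OF v \<rho>v _ y(1) _ arc_polarity[OF x(1)]] 2 j_def by blast
    then have False
      using min[OF xV] y(2) 2 by (simp add: j_def)
    then show ?thesis ..
  next
    case 3
    then show ?thesis
      using min d_le_n polarity_V unfolding j_def by (metis le_antisym)
  qed
qed

text \<open>
  For \<open>q = 1\<close> the graph is a \<open>2 * n\<close>-cycle: a geodesic from \<open>v\<close> to its opposite \<open>\<rho> v\<close>, followed by the
  image of that geodesic, closes up, has no repetitions because \<open>\<rho>\<close> never moves a vertex by less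
  than \<open>n\<close>, and is everything because all degrees are 2. In this labelling \<open>\<rho>\<close> advances every index
  by \<open>n\<close>.
\<close>
lemma rotation_if_all_opposite:
  assumes "q = 1" and opp: "\<And>v. v \<in> V \<Longrightarrow> d v (\<rho> v) = n"
  shows "rotation_polarity n G \<rho>"
proof -
  obtain v where v: "v \<in> V" using diameter_bounds(2) by blast
  note \<rho>v = polarity_V[OF v]
  have "odd n" using odd_d_polarity[OF v] opp[OF v] by simp
  have n3: "3 \<le> n" using \<open>odd n\<close> n_ge_2 by presburger
  obtain a where a: "a 0 = v" "a n = \<rho> v" "\<And>i. i < n \<Longrightarrow> (a i, a (Suc i)) \<in> E"
    using walk_d[OF v \<rho>v] opp[OF v] unfolding relpow_fun_conv by auto
  have aV: "a i \<in> V" if "i \<le> n" for i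
    using a(2) \<rho>v arcD(1)[OF a(3), of i] that by (cases "i = n") auto
  have da: "d (a i) (a j) \<le> j - i" if "i \<le> j" "j \<le> n" for i j
    using relpow_segment[of n a E i j] a(3) that by (intro d_le) auto
  have inj_a: "i = j" if "i \<le> j" "j \<le> n" "a i = a j" for i j
  proof -
    have "n \<le> i + (n - j)"
      using d_triangle[OF aV aV aV, of 0 i n] da[of 0 i] da[of j n] that opp[OF v] a(1,2) by auto
    then show ?thesis using that by simp
  qed
  have a_opp: "a i \<noteq> \<rho> (a j)" if "i < n" "j < n" for i j
  proof
    assume eq: "a i = \<rho> (a j)"
    then have "d (a i) (a j) = n"
      using opp[of "a j"] aV that d_sym by simp
    then show False
      using da[of i j] da[of j i] d_sym[of "a i" "a j"] that by (cases "i \<le> j") auto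
  qed
  define f where "f i = (if i < n then a i else \<rho> (a (i - n)))" for i
  \<comment> \<open>The cyclic predecessor on the indices below \<open>2 * n\<close>.\<close>
  define prev where "prev i = (if i = 0 then 2 * n - 1 else i - 1)" for i
  have fV: "f i \<in> V" if "i < 2 * n" for i
    using that aV polarity_V by (auto simp: f_def)
  have inj_f: "i = j" if "i \<le> j" "j < 2 * n" "f i = f j" for i j
  proof -
    consider "j < n" | "i < n" "n \<le> j" | "n \<le> i" using that by linarith
    then show ?thesis
    proof cases
      case 1
      then show ?thesis using inj_a that by (simp add: f_def)
    next
      case 2
      then show ?thesis using a_opp[of i "j - n"] that by (simp add: f_def)
    next
      case 3
      then have "\<rho> (a (i - n)) = \<rho> (a (j - n))" using that by (simp add: f_def)
      then have "\<rho> (\<rho> (a (i - n))) = \<rho> (\<rho> (a (j - n)))" by simp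
      then have "a (i - n) = a (j - n)"
        using involution[OF aV[of "i - n"]] involution[OF aV[of "j - n"]] 3 that by auto
      then show ?thesis using inj_a[of "i - n" "j - n"] 3 that by linarith
    qed
  qed
  have inj: "inj_on f {..<2 * n}"
    unfolding inj_on_def using inj_f by (metis lessThan_iff nat_le_linear)
  have next_arc: "(f i, f (Suc i mod (2 * n))) \<in> E" if "i < 2 * n" for i
  proof -
    have "Suc i < n \<or> Suc i = n \<or> (n \<le> i \<and> Suc i < 2 * n) \<or> Suc i = 2 * n"
      using that by arith
    then consider "Suc i < n" | "Suc i = n" | "n \<le> i" "Suc i < 2 * n" | "Suc i = 2 * n"
      by blast
    then show ?thesis
    proof cases
      case 1
      then show ?thesis using a(3)[of i] by (simp add: f_def)
    next
      case 2
      then show ?thesis using a(3)[of i] a(1,2) n3 by (auto simp: f_def)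
    next
      case 3
      then show ?thesis
        using arc_polarity[OF a(3)[of "i - n"]] by (simp add: f_def Suc_diff_le)
    next
      case 4
      then have "Suc (i - n) = n" using n3 by simp
      then show ?thesis
        using arc_polarity[OF a(3)[of "i - n"]] 4 n3 a(1,2) involution[OF v]
        by (auto simp: f_def)
    qed
  qed
  have prev: "prev i < 2 * n" "Suc (prev i) mod (2 * n) = i" "prev i \<noteq> Suc i mod (2 * n)"
    if "i < 2 * n" for i
    using that n3 by (auto simp: prev_def mod_Suc)
  have nbrs: "{w. (f i, w) \<in> E} = {f (Suc i mod (2 * n)), f (prev i)}" if "i < 2 * n" for i
  proof -
    have sub: "{f (Suc i mod (2 * n)), f (prev i)} \<subseteq> {w. (f i, w) \<in> E}"
      using next_arc[OF that] next_arc[OF prev(1)[OF that]] prev(2)[OF that] sym_arcs by auto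
    have "f (Suc i mod (2 * n)) \<noteq> f (prev i)"
      using inj_onD[OF inj, of "Suc i mod (2 * n)" "prev i"] prev[OF that] n3 by auto
    then have "card {f (Suc i mod (2 * n)), f (prev i)} = card {w. (f i, w) \<in> E}"
      using degree[OF fV[OF that]] assms(1) by simp
    then show ?thesis
      using card_subset_eq[OF finite_neighbours[OF fV[OF that]] sub] by simp
  qed
  have "x \<in> f ` {..<2 * n}" if "(f 0, x) \<in> E ^^ k" for x k
    using that
  proof (induction k arbitrary: x)
    case 0
    then show ?case using n3 by auto
  next
    case (Suc k)
    then obtain y where "y \<in> f ` {..<2 * n}" "(y, x) \<in> E" by (meson relpow_Suc_E)
    then obtain i where i: "i < 2 * n" "(f i, x) \<in> E" by auto
    then have "x \<in> {f (Suc i mod (2 * n)), f (prev i)}" using nbrs[OF i(1)] by blast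
    then show ?case using prev(1)[OF i(1)] n3 by auto
  qed
  then have "f ` {..<2 * n} = V"
    using walk_d[OF fV[of 0]] fV n3 by fastforce
  then have bij: "bij_betw f {..<2 * n} V"
    using inj by (simp add: bij_betw_def)
  have adj: "(j = Suc i mod (2 * n) \<or> i = Suc j mod (2 * n)) \<longleftrightarrow> (f i, f j) \<in> E"
    if "i < 2 * n" "j < 2 * n" for i j
  proof
    assume "(f i, f j) \<in> E"
    then have "f j = f (Suc i mod (2 * n)) \<or> f j = f (prev i)" using nbrs[OF that(1)] by blast
    then have "j = Suc i mod (2 * n) \<or> j = prev i"
      using inj_onD[OF inj] that prev(1)[OF that(1)] n3 by auto
    then show "j = Suc i mod (2 * n) \<or> i = Suc j mod (2 * n)"
      using prev(2)[OF that(1)] by auto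
  qed (use next_arc that sym_arcs in auto)
  have "graph_isomorphism f (cycle_graph (2 * n)) G"
    unfolding graph_isomorphism_def using bij adj by (simp add: cycle_graph_def)
  moreover have "\<rho> (f i) = f ((i + n) mod (2 * n))" if "i < 2 * n" for i
    using that involution[OF aV[of "i - n"]] by (auto simp: f_def mod_if)
  ultimately show ?thesis
    unfolding rotation_polarity_def using \<open>odd n\<close> by blast
qed

text \<open>
  This is where rotations have to be excluded: they send every vertex to its opposite, so that
  each orbit comes within \<open>(n - 1) / 2\<close> steps of each vertex.
\<close>
lemma orbit_at_distance:
  assumes "\<not> rotation_polarity n G \<rho>"
  obtains v u where "v \<in> V" "u \<in> V" "\<And>k. k < n - 1 \<Longrightarrow> (v, u) \<notin> E ^^ k \<and> (v, \<rho> u) \<notin> E ^^ k"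
proof -
  have "\<exists>v\<in>V. \<exists>u\<in>V. d v u = n - 1 \<and> d v (\<rho> u) = n"
  proof (cases "q = 1")
    case True
    then show ?thesis
      using absolute_or_all_opposite rotation_if_all_opposite far_orbit_if_absolute assms arcD
      by blast
  next
    case False
    then show ?thesis using far_orbit_if_thick q_ge_1 by simp
  qed
  then obtain v u where "v \<in> V" "u \<in> V" "d v u = n - 1" "d v (\<rho> u) = n" by blast
  then show thesis
    using d_le[of v u] d_le[of v "\<rho> u"] by (intro that[of v u]) fastforce+
qed

end

section \<open>Polarity quotients\<close>

text \<open>
  Quotients by an involution are treated apart from bipartite graphs, so that the results apply to
  the two polygons and to the component of their product alike.
\<close>
locale involutive_automorphism =
  fixes G :: "'a pair_pre_digraph" and \<rho> :: "'a \<Rightarrow> 'a"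
  assumes wf: "pair_wf_digraph G"
    and iso: "graph_isomorphism \<rho> G G"
    and involution: "v \<in> pverts G \<Longrightarrow> \<rho> (\<rho> v) = v"
begin

abbreviation "Q \<equiv> polarity_quotient G \<rho>"

lemma arcD: "(u, v) \<in> parcs G \<Longrightarrow> u \<in> pverts G" "(u, v) \<in> parcs G \<Longrightarrow> v \<in> pverts G"
  using pair_wf_digraph.in_arcsD1[OF wf] pair_wf_digraph.in_arcsD2[OF wf] by blast+

lemma map_vert: "v \<in> pverts G \<Longrightarrow> \<rho> v \<in> pverts G"
  using iso by (auto simp: graph_isomorphism_def bij_betw_def)

lemma map_arc: "(u, v) \<in> parcs G \<Longrightarrow> (\<rho> u, \<rho> v) \<in> parcs G"
  using iso arcD[of u v] by (simp add: graph_isomorphism_def)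

lemma pverts_quotient: "pverts Q = (\<lambda>v. {v, \<rho> v}) ` pverts G"
  by (auto simp: polarity_quotient_def)

lemma orbit_eq_iff:
  assumes "u \<in> pverts G" "w \<in> pverts G"
  shows "{u, \<rho> u} = {w, \<rho> w} \<longleftrightarrow> u \<in> {w, \<rho> w}"
  using involution[OF assms(1)] involution[OF assms(2)] by auto

lemma orbit_closed: "w \<in> pverts G \<Longrightarrow> w' \<in> {w, \<rho> w} \<Longrightarrow> \<rho> w' \<in> {w, \<rho> w}"
  using involution by auto

lemma wf_quotient: "pair_wf_digraph Q"
  by unfold_locales (auto simp: polarity_quotient_def)

lemma arc_quotient_iff:
  assumes "u \<in> pverts G" "w \<in> pverts G"
  shows "({u, \<rho> u}, {w, \<rho> w}) \<in> parcs Q \<longleftrightarrow> (\<exists>w'\<in>{w, \<rho> w}. (u, w') \<in> parcs G)"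
proof
  assume "({u, \<rho> u}, {w, \<rho> w}) \<in> parcs Q"
  then obtain u' w' where *: "u' \<in> {u, \<rho> u}" "w' \<in> {w, \<rho> w}" "(u', w') \<in> parcs G"
    unfolding polarity_quotient_def by auto
  show "\<exists>w'\<in>{w, \<rho> w}. (u, w') \<in> parcs G"
  proof (cases "u' = u")
    case False
    then have "(u, \<rho> w') \<in> parcs G"
      using map_arc[OF *(3)] *(1) involution[OF assms(1)] by auto
    then show ?thesis using orbit_closed[OF assms(2) *(2)] by blast
  qed (use * in blast)
next
  assume "\<exists>w'\<in>{w, \<rho> w}. (u, w') \<in> parcs G"
  then show "({u, \<rho> u}, {w, \<rho> w}) \<in> parcs Q"
    unfolding polarity_quotient_def using assms by auto
qed

text \<open>
  Walks lift along the quotient map from any chosen first vertex, because \<open>\<rho>\<close> can be applied to the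
  remaining part of the walk at every step.
\<close>
lemma relpow_quotient_iff:
  assumes "u \<in> pverts G" "w \<in> pverts G"
  shows "({u, \<rho> u}, {w, \<rho> w}) \<in> parcs Q ^^ k \<longleftrightarrow> (\<exists>w'\<in>{w, \<rho> w}. (u, w') \<in> parcs G ^^ k)"
  using assms(2)
proof (induction k arbitrary: w)
  case 0
  then show ?case using orbit_eq_iff[OF assms(1)] by auto
next
  case (Suc k)
  show ?case
  proof
    assume "({u, \<rho> u}, {w, \<rho> w}) \<in> parcs Q ^^ Suc k"
    then obtain X where X: "({u, \<rho> u}, X) \<in> parcs Q ^^ k" "(X, {w, \<rho> w}) \<in> parcs Q"
      by (rule relpow_Suc_E)
    then obtain x where x: "x \<in> pverts G" "X = {x, \<rho> x}"
      using pair_wf_digraph.in_arcsD1[OF wf_quotient] pverts_quotient by auto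
    then obtain x' where x': "x' \<in> {x, \<rho> x}" "(u, x') \<in> parcs G ^^ k"
      using X(1) Suc.IH by blast
    have "x' \<in> pverts G" using x x' map_vert by auto
    then have "X = {x', \<rho> x'}" using orbit_eq_iff x x' by auto
    then obtain w' where "w' \<in> {w, \<rho> w}" "(x', w') \<in> parcs G"
      using X(2) arc_quotient_iff \<open>x' \<in> pverts G\<close> Suc.prems by blast
    then show "\<exists>w'\<in>{w, \<rho> w}. (u, w') \<in> parcs G ^^ Suc k"
      using x'(2) by (meson relpow_Suc_I)
  next
    assume "\<exists>w'\<in>{w, \<rho> w}. (u, w') \<in> parcs G ^^ Suc k"
    then obtain w' x where w': "w' \<in> {w, \<rho> w}" "(u, x) \<in> parcs G ^^ k" "(x, w') \<in> parcs G"
      by (meson relpow_Suc_E)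
    then have "x \<in> pverts G" using arcD by blast
    then have "({u, \<rho> u}, {x, \<rho> x}) \<in> parcs Q ^^ k" "({x, \<rho> x}, {w, \<rho> w}) \<in> parcs Q"
      using Suc.IH[of x] arc_quotient_iff[of x w] w' Suc.prems by blast+
    then show "({u, \<rho> u}, {w, \<rho> w}) \<in> parcs Q ^^ Suc k"
      by (rule relpow_Suc_I)
  qed
qed

end

context polarized_polygon
begin

sublocale aut: involutive_automorphism G \<rho>
  using wf iso involution by (rule involutive_automorphism.intro)

text \<open>
  Exact lengths of walks are recorded rather than distances, because both coordinates of a walk in a
  Kronecker product move simultaneously.
\<close>
lemma quotient_walks_if_long:
  assumes "X \<in> pverts aut.Q" "Y \<in> pverts aut.Q" "n - 1 \<le> k"
  shows "(X, Y) \<in> parcs aut.Q ^^ k"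
  using assms aut.relpow_quotient_iff walk_to_orbit unfolding aut.pverts_quotient by auto

lemma quotient_pair_without_short_walks:
  assumes "\<not> rotation_polarity n G \<rho>"
  shows "\<exists>X\<in>pverts aut.Q. \<exists>Y\<in>pverts aut.Q. \<forall>k<n - 1. (X, Y) \<notin> parcs aut.Q ^^ k"
proof -
  obtain v u where "v \<in> V" "u \<in> V" "\<And>k. k < n - 1 \<Longrightarrow> (v, u) \<notin> E ^^ k \<and> (v, \<rho> u) \<notin> E ^^ k"
    using orbit_at_distance[OF assms] by blast
  then show ?thesis
    unfolding aut.pverts_quotient using aut.relpow_quotient_iff[of v u]
    by (intro bexI[of _ "{v, \<rho> v}"] bexI[of _ "{u, \<rho> u}"]) auto
qed

end

section \<open>Kronecker products\<close>

lemma wf_kronecker: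
  assumes "pair_wf_digraph H" "pair_wf_digraph K"
  shows "pair_wf_digraph (H \<otimes>\<^sub>K K)"
  using pair_wf_digraph.in_arcsD1[OF assms(1)] pair_wf_digraph.in_arcsD2[OF assms(1)]
    pair_wf_digraph.in_arcsD1[OF assms(2)] pair_wf_digraph.in_arcsD2[OF assms(2)]
  by (intro pair_wf_digraph.intro) (auto simp: kronecker_def)

lemma relpow_kronecker_iff:
  "((h, k), (h', k')) \<in> parcs (H \<otimes>\<^sub>K K) ^^ i \<longleftrightarrow> (h, h') \<in> parcs H ^^ i \<and> (k, k') \<in> parcs K ^^ i"
proof (induction i arbitrary: h' k')
  case (Suc i)
  have arc: "((a, b), (h', k')) \<in> parcs (H \<otimes>\<^sub>K K) \<longleftrightarrow> (a, h') \<in> parcs H \<and> (b, k') \<in> parcs K" for a b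
    by (simp add: kronecker_def)
  show ?case
    using Suc arc by (auto simp: relcomp_unfold)
qed auto

text \<open>
  A walk in the product is a pair of walks of the same length. If all lengths from \<open>a\<close> and from \<open>b\<close> on
  are realised in the factors, the length \<open>max a b\<close> is realised in both at once. Combining pairs that
  admit no shorter walk in either factor shows that this bound is attained.
\<close>
lemma graph_diameter_kronecker:
  fixes Q :: "'a pair_pre_digraph" and R :: "'b pair_pre_digraph" and a b :: nat
  assumes "pair_wf_digraph Q" "pair_wf_digraph R" "1 \<le> a" "1 \<le> b"
    and "\<And>X Y k. X \<in> pverts Q \<Longrightarrow> Y \<in> pverts Q \<Longrightarrow> a \<le> k \<Longrightarrow> (X, Y) \<in> parcs Q ^^ k"
    and "\<And>X Y k. X \<in> pverts R \<Longrightarrow> Y \<in> pverts R \<Longrightarrow> b \<le> k \<Longrightarrow> (X, Y) \<in> parcs R ^^ k"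
    and far_Q: "\<exists>X\<in>pverts Q. \<exists>Y\<in>pverts Q. \<forall>k<a. (X, Y) \<notin> parcs Q ^^ k"
    and far_R: "\<exists>X\<in>pverts R. \<exists>Y\<in>pverts R. \<forall>k<b. (X, Y) \<notin> parcs R ^^ k"
  shows "graph_diameter (Q \<otimes>\<^sub>K R) = enat (max a b)"
proof -
  have verts: "pverts (Q \<otimes>\<^sub>K R) = pverts Q \<times> pverts R"
    by (simp add: kronecker_def)
  obtain c where c: "max a b = Suc c" using assms(3) by (cases "max a b") auto
  have "\<exists>j\<le>Suc c. (u, v) \<in> parcs (Q \<otimes>\<^sub>K R) ^^ j"
    if uv: "u \<in> pverts (Q \<otimes>\<^sub>K R)" "v \<in> pverts (Q \<otimes>\<^sub>K R)" for u v
  proof -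
    obtain X Y X' Y' where "u = (X, Y)" "v = (X', Y')" by (metis surj_pair)
    then have "(u, v) \<in> parcs (Q \<otimes>\<^sub>K R) ^^ max a b"
      using uv assms(5,6) by (simp add: verts relpow_kronecker_iff)
    then show ?thesis unfolding c by blast
  qed
  moreover have "\<exists>u\<in>pverts (Q \<otimes>\<^sub>K R). \<exists>v\<in>pverts (Q \<otimes>\<^sub>K R). \<forall>j\<le>c. (u, v) \<notin> parcs (Q \<otimes>\<^sub>K R) ^^ j"
  proof -
    obtain X X' where X: "X \<in> pverts Q" "X' \<in> pverts Q" "\<forall>k<a. (X, X') \<notin> parcs Q ^^ k"
      using far_Q by blast
    obtain Y Y' where Y: "Y \<in> pverts R" "Y' \<in> pverts R" "\<forall>k<b. (Y, Y') \<notin> parcs R ^^ k"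
      using far_R by blast
    have "j < a \<or> j < b" if "j \<le> c" for j using that c by linarith
    then have "((X, Y), (X', Y')) \<notin> parcs (Q \<otimes>\<^sub>K R) ^^ j" if "j \<le> c" for j
      using that X(3) Y(3) by (auto simp: relpow_kronecker_iff)
    then show ?thesis using X(1,2) Y(1,2) unfolding verts by blast
  qed
  ultimately show ?thesis
    unfolding c using graph_diameter_eq_Suc_iff[OF wf_kronecker[OF assms(1,2)]] by blast
qed

text \<open>
  An orbit of the composed polarity is a set of pairs whose two projections are orbits of the
  factors. Conversely, two orbits \<open>{h, \<rho> h}\<close> and \<open>{k, \<sigma> k}\<close> give four pairs, which are divided among
  the two components, one composed orbit to each. The truth value \<open>s\<close> selects the component: an edge
  of the product changes the part in both coordinates, so agreement of the parts is invariant.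
\<close>
lemma component_quotient_iso:
  fixes H :: "'a pair_pre_digraph" and K :: "'b pair_pre_digraph"
  assumes "involutive_automorphism H \<rho>" "involutive_automorphism K \<sigma>"
    and bip_H: "\<And>u v. (u, v) \<in> parcs H \<Longrightarrow> (u \<in> A) \<noteq> (v \<in> A)"
    and bip_K: "\<And>u v. (u, v) \<in> parcs K \<Longrightarrow> (u \<in> C) \<noteq> (v \<in> C)"
    and swap_H: "\<And>v. v \<in> pverts H \<Longrightarrow> (\<rho> v \<in> A) \<noteq> (v \<in> A)"
    and swap_K: "\<And>v. v \<in> pverts K \<Longrightarrow> (\<sigma> v \<in> C) \<noteq> (v \<in> C)"
    and U: "U = {(h, k). h \<in> pverts H \<and> k \<in> pverts K \<and> ((h \<in> A) = (k \<in> C)) = s}"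
    and M: "M = pair_induced (H \<otimes>\<^sub>K K) U"
  shows "involutive_automorphism M (composed_polarity \<rho> \<sigma>)"
    and "graph_isomorphism (\<lambda>X. (fst ` X, snd ` X)) (polarity_quotient M (composed_polarity \<rho> \<sigma>))
           (polarity_quotient H \<rho> \<otimes>\<^sub>K polarity_quotient K \<sigma>)"
proof -
  interpret H: involutive_automorphism H \<rho> by fact
  interpret K: involutive_automorphism K \<sigma> by fact
  let ?c = "composed_polarity \<rho> \<sigma>" and ?F = "\<lambda>X. (fst ` X, snd ` X)"
  have c: "?c (h, k) = (\<rho> h, \<sigma> k)" for h k
    by (simp add: composed_polarity_def)
  have verts: "pverts M = U"
    by (simp add: M pair_induced_def)
  have arcs: "((h, k), (h', k')) \<in> parcs M \<longleftrightarrow>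
      (h, k) \<in> U \<and> (h, h') \<in> parcs H \<and> (k, k') \<in> parcs K" for h k h' k'
    using bip_H[of h h'] bip_K[of k k'] H.arcD K.arcD
    by (auto simp: M U pair_induced_def kronecker_def)
  have cU: "?c x \<in> U" "?c (?c x) = x" if "x \<in> U" for x
    using that H.map_vert K.map_vert H.involution K.involution swap_H swap_K
    by (auto simp: U c)
  have "bij_betw ?c U U"
    using cU by (intro bij_betw_byWitness[of _ ?c]) auto
  moreover have "(?c x, ?c y) \<in> parcs M \<longleftrightarrow> (x, y) \<in> parcs M" if "x \<in> U" "y \<in> U" for x y
  proof -
    have map: "(?c x, ?c y) \<in> parcs M" if "x \<in> U" "(x, y) \<in> parcs M" for x y
      using that cU(1)[of x] H.map_arc K.map_arc by (cases x; cases y) (auto simp: c arcs)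
    show ?thesis
      using map[of x y] map[of "?c x" "?c y"] cU that by auto
  qed
  moreover have "pair_wf_digraph M"
    by unfold_locales (auto simp: M pair_induced_def)
  ultimately show aut: "involutive_automorphism M ?c"
    using cU by (intro involutive_automorphism.intro) (simp_all add: graph_isomorphism_def verts)
  interpret M: involutive_automorphism M ?c by fact
  have F: "?F {(h, k), ?c (h, k)} = ({h, \<rho> h}, {k, \<sigma> k})" for h k
    by (simp add: c)
  have orbit: "(h', k') \<in> {(h, k), ?c (h, k)}"
    if "(h, k) \<in> U" "(h', k') \<in> U" "h' \<in> {h, \<rho> h}" "k' \<in> {k, \<sigma> k}" for h k h' k'
    using that swap_H[of h] swap_K[of k] by (auto simp: U c)
  have inj: "inj_on ?F (pverts M.Q)"
  proof (rule inj_onI)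
    fix X Y assume XY: "X \<in> pverts M.Q" "Y \<in> pverts M.Q" and eq: "?F X = ?F Y"
    obtain h k where X: "X = {(h, k), ?c (h, k)}" "(h, k) \<in> U"
      using XY(1) unfolding M.pverts_quotient verts by auto
    obtain h' k' where Y: "Y = {(h', k'), ?c (h', k')}" "(h', k') \<in> U"
      using XY(2) unfolding M.pverts_quotient verts by auto
    have "{h, \<rho> h} = {h', \<rho> h'}" "{k, \<sigma> k} = {k', \<sigma> k'}"
      using eq unfolding X(1) Y(1) F by auto
    then have "(h, k) \<in> {(h', k'), ?c (h', k')}"
      using orbit[OF Y(2) X(2)] by blast
    then show "X = Y"
      unfolding X(1) Y(1) using M.orbit_eq_iff X(2) Y(2) verts by blast
  qed
  have "?F ` pverts M.Q = pverts (H.Q \<otimes>\<^sub>K K.Q)"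
  proof
    show "?F ` pverts M.Q \<subseteq> pverts (H.Q \<otimes>\<^sub>K K.Q)"
      by (auto simp: M.pverts_quotient verts F kronecker_def H.pverts_quotient K.pverts_quotient U c)
    show "pverts (H.Q \<otimes>\<^sub>K K.Q) \<subseteq> ?F ` pverts M.Q"
    proof
      fix Z assume "Z \<in> pverts (H.Q \<otimes>\<^sub>K K.Q)"
      then obtain h k where hk: "h \<in> pverts H" "k \<in> pverts K" "Z = ({h, \<rho> h}, {k, \<sigma> k})"
        by (auto simp: kronecker_def H.pverts_quotient K.pverts_quotient)
      \<comment> \<open>Exactly one of \<open>(h, k)\<close> and \<open>(h, \<sigma> k)\<close> lies in the component.\<close>
      obtain k' where k': "k' \<in> {k, \<sigma> k}" "(h, k') \<in> U"
        using hk swap_K[of k] K.map_vert[of k] by (auto simp: U)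
      then have "Z = ?F {(h, k'), ?c (h, k')}"
        unfolding F using hk K.orbit_eq_iff[of k' k] by (auto simp: U)
      then show "Z \<in> ?F ` pverts M.Q"
        unfolding M.pverts_quotient verts using k'(2) by blast
    qed
  qed
  then have "bij_betw ?F (pverts M.Q) (pverts (H.Q \<otimes>\<^sub>K K.Q))"
    using inj by (simp add: bij_betw_def)
  moreover have "(X, Y) \<in> parcs M.Q \<longleftrightarrow> (?F X, ?F Y) \<in> parcs (H.Q \<otimes>\<^sub>K K.Q)"
    if XY: "X \<in> pverts M.Q" "Y \<in> pverts M.Q" for X Y
  proof -
    obtain h k where X: "X = {(h, k), ?c (h, k)}" "(h, k) \<in> U"
      using XY(1) unfolding M.pverts_quotient verts by auto
    obtain h' k' where Y: "Y = {(h', k'), ?c (h', k')}" "(h', k') \<in> U"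
      using XY(2) unfolding M.pverts_quotient verts by auto
    have V: "h \<in> pverts H" "k \<in> pverts K" "h' \<in> pverts H" "k' \<in> pverts K"
      using X(2) Y(2) by (auto simp: U)
    have "(X, Y) \<in> parcs M.Q \<longleftrightarrow> (\<exists>y\<in>{(h', k'), ?c (h', k')}. ((h, k), y) \<in> parcs M)"
      unfolding X(1) Y(1) using M.arc_quotient_iff X(2) Y(2) verts by blast
    also have "\<dots> \<longleftrightarrow>
      (\<exists>x\<in>{h', \<rho> h'}. (h, x) \<in> parcs H) \<and> (\<exists>x\<in>{k', \<sigma> k'}. (k, x) \<in> parcs K)"
    proof
      assume "(\<exists>x\<in>{h', \<rho> h'}. (h, x) \<in> parcs H) \<and> (\<exists>x\<in>{k', \<sigma> k'}. (k, x) \<in> parcs K)"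
      then obtain x y where xy: "x \<in> {h', \<rho> h'}" "(h, x) \<in> parcs H" "y \<in> {k', \<sigma> k'}" "(k, y) \<in> parcs K"
        by blast
      then have "(x, y) \<in> U"
        using X(2) bip_H[of h x] bip_K[of k y] H.arcD K.arcD by (auto simp: U)
      then have "(x, y) \<in> {(h', k'), ?c (h', k')}"
        using orbit[OF Y(2)] xy by blast
      then show "\<exists>y\<in>{(h', k'), ?c (h', k')}. ((h, k), y) \<in> parcs M"
        using xy arcs X(2) by blast
    qed (auto simp: arcs c)
    also have "\<dots> \<longleftrightarrow> (?F X, ?F Y) \<in> parcs (H.Q \<otimes>\<^sub>K K.Q)"
      unfolding X(1) Y(1) F using H.arc_quotient_iff K.arc_quotient_iff V by (simp add: kronecker_def)
    finally show ?thesis .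
  qed
  ultimately show "graph_isomorphism ?F M.Q (H.Q \<otimes>\<^sub>K K.Q)"
    unfolding graph_isomorphism_def by blast
qed

section \<open>Incidence graphs\<close>

lemma polygon_graph_incidence_graph:
  fixes P :: "'p set" and L :: "'l set" and I :: "('p \<times> 'l) set" and n q :: nat
  assumes poly: "generalized_polygon n P L I" and ord: "has_order P L I q q" and "1 \<le> q"
  shows "polygon_graph (incidence_graph P L I) (Inl ` P) n q"
proof (rule polygon_graph.intro)
  let ?G = "incidence_graph P L I"
  have I: "I \<subseteq> P \<times> L"
    using poly by (simp add: generalized_polygon_def)
  have arcs: "(Inl p, w) \<in> parcs ?G \<longleftrightarrow> w \<in> Inr ` {l \<in> L. (p, l) \<in> I}"
      "(Inr l, w) \<in> parcs ?G \<longleftrightarrow> w \<in> Inl ` {p \<in> P. (p, l) \<in> I}" for p l w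
    using I by (auto simp: incidence_graph_def)
  show "pair_wf_digraph ?G"
    using I by unfold_locales (auto simp: incidence_graph_def)
  show "(v, u) \<in> parcs ?G" if "(u, v) \<in> parcs ?G" for u v
    using that by (auto simp: incidence_graph_def)
  show "(u \<in> Inl ` P) \<noteq> (v \<in> Inl ` P)" if "(u, v) \<in> parcs ?G" for u v
    using that I by (auto simp: incidence_graph_def)
  show "2 \<le> n" "graph_diameter ?G = enat n" "girth ?G = enat (2 * n)" "1 \<le> q"
    using poly assms(3) by (simp_all add: generalized_polygon_def)
  show "card {w. (v, w) \<in> parcs ?G} = q + 1" if "v \<in> pverts ?G" for v
  proof (cases v)
    case (Inl p)
    then have "{w. (v, w) \<in> parcs ?G} = Inr ` {l \<in> L. (p, l) \<in> I}" using arcs(1) by blast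
    then show ?thesis
      using that ord Inl by (auto simp: has_order_def card_image incidence_graph_def)
  next
    case (Inr l)
    then have "{w. (v, w) \<in> parcs ?G} = Inl ` {p \<in> P. (p, l) \<in> I}" using arcs(2) by blast
    then show ?thesis
      using that ord Inr by (auto simp: has_order_def card_image incidence_graph_def)
  qed
qed

lemma polarized_polygon_incidence_graph:
  fixes P :: "'p set" and L :: "'l set" and I :: "('p \<times> 'l) set" and n q :: nat
  assumes "generalized_polygon n P L I" "has_order P L I q q" "1 \<le> q"
    and pol: "polarity (incidence_graph P L I) (Inl ` P) (Inr ` L) \<rho>"
  shows "polarized_polygon (incidence_graph P L I) (Inl ` P) n q \<rho>"
proof (intro polarized_polygon.intro polarized_polygon_axioms.intro)
  let ?G = "incidence_graph P L I"
  show "polygon_graph ?G (Inl ` P) n q"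
    using polygon_graph_incidence_graph assms(1-3) .
  show "graph_isomorphism \<rho> ?G ?G" "\<And>v. v \<in> pverts ?G \<Longrightarrow> \<rho> (\<rho> v) = v"
    using pol by (simp_all add: polarity_def)
  have "\<rho> ` Inl ` P = Inr ` L" "\<rho> ` Inr ` L = Inl ` P"
    using pol by (simp_all add: polarity_def)
  then have "\<And>p. p \<in> P \<Longrightarrow> \<rho> (Inl p) \<in> Inr ` L" "\<And>l. l \<in> L \<Longrightarrow> \<rho> (Inr l) \<in> Inl ` P"
    by blast+
  then show "(\<rho> v \<in> Inl ` P) \<noteq> (v \<in> Inl ` P)" if "v \<in> pverts ?G" for v
    using that by (fastforce simp: incidence_graph_def)
qed

section \<open>The diameter of the product of two polarity quotients\<close>

theorem corollary6p9:
  fixes P :: "'p set" and L :: "'l set" and I :: "('p \<times> 'l) set"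
    and P' :: "'s set" and L' :: "'t set" and I' :: "('s \<times> 't) set"
    and G :: "('p + 'l) pair_pre_digraph" and H :: "('s + 't) pair_pre_digraph"
    and \<rho> :: "'p + 'l \<Rightarrow> 'p + 'l" and \<sigma> :: "'s + 't \<Rightarrow> 's + 't"
    and GH :: "(('p + 'l) \<times> ('s + 't)) pair_pre_digraph"
    and m n q r :: nat
  assumes "q \<ge> 1" and "r \<ge> 1"
    and "generalized_polygon m P L I" and "has_order P L I q q"
    and "generalized_polygon n P' L' I'" and "has_order P' L' I' r r"
    and "G = incidence_graph P L I" and "H = incidence_graph P' L' I'"
    and "polarity G (Inl ` P) (Inr ` L) \<rho>" and "\<not> rotation_polarity m G \<rho>"
    and "polarity H (Inl ` P') (Inr ` L') \<sigma>" and "\<not> rotation_polarity n H \<sigma>"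
    and "GH \<in> kronecker_components G (Inl ` P) (Inr ` L) H (Inl ` P') (Inr ` L')"
  shows "digraph_iso (polarity_quotient GH (composed_polarity \<rho> \<sigma>))
           (polarity_quotient G \<rho> \<otimes>\<^sub>K polarity_quotient H \<sigma>)
       \<and> graph_diameter (polarity_quotient GH (composed_polarity \<rho> \<sigma>)) = enat (max m n - 1)
       \<and> graph_diameter (polarity_quotient G \<rho> \<otimes>\<^sub>K polarity_quotient H \<sigma>) = enat (max m n - 1)"
proof -
  interpret G: polarized_polygon G "Inl ` P" m q \<rho>
    using polarized_polygon_incidence_graph[OF assms(3,4,1)] assms(7,9) by simp
  interpret H: polarized_polygon H "Inl ` P'" n r \<sigma>
    using polarized_polygon_incidence_graph[OF assms(5,6,2)] assms(8,11) by simp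
  let ?PGH = "polarity_quotient GH (composed_polarity \<rho> \<sigma>)" and ?K = "G.aut.Q \<otimes>\<^sub>K H.aut.Q"
  have verts: "pverts G = Inl ` P \<union> Inr ` L" "pverts H = Inl ` P' \<union> Inr ` L'"
    using assms(7,8) by (simp_all add: incidence_graph_def)
  define U where "U s = {(h, k). h \<in> pverts G \<and> k \<in> pverts H \<and> ((h \<in> Inl ` P) = (k \<in> Inl ` P')) = s}"
    for s
  have "U True = Inl ` P \<times> Inl ` P' \<union> Inr ` L \<times> Inr ` L'"
    "U False = Inl ` P \<times> Inr ` L' \<union> Inr ` L \<times> Inl ` P'"
    unfolding U_def verts by auto
  then have "GH \<in> {pair_induced (G \<otimes>\<^sub>K H) (U True), pair_induced (G \<otimes>\<^sub>K H) (U False)}"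
    using assms(13) by (simp only: kronecker_components_def)
  then obtain s where GH: "GH = pair_induced (G \<otimes>\<^sub>K H) (U s)"
    by blast
  note component = component_quotient_iso[OF G.aut.involutive_automorphism_axioms
      H.aut.involutive_automorphism_axioms G.bipartite H.bipartite G.swaps H.swaps U_def GH]
  have wf: "pair_wf_digraph ?PGH" "pair_wf_digraph ?K"
    using involutive_automorphism.wf_quotient[OF component(1)]
      wf_kronecker[OF G.aut.wf_quotient H.aut.wf_quotient] by auto
  have "graph_diameter ?K = enat (max (m - 1) (n - 1))"
    using G.n_ge_2 H.n_ge_2 G.quotient_walks_if_long H.quotient_walks_if_long
      G.quotient_pair_without_short_walks[OF assms(10)]
      H.quotient_pair_without_short_walks[OF assms(12)]
    by (intro graph_diameter_kronecker G.aut.wf_quotient H.aut.wf_quotient) auto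
  moreover have "max (m - 1) (n - 1) = max m n - 1"
    by simp
  ultimately show ?thesis
    using digraph_iso_if_graph_isomorphism[OF wf component(2)] graph_diameter_iso[OF wf component(2)]
    by simp
qed

end
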